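(* Let $\Delta_5=\{\mathbf{0},e_1,\dots,e_5\}\subset\mathbb{Z}^5$. Then $\operatorname{rc}(\Delta_5)=5$.
   Context: Here $e_1,\dots,e_5$ are the standard unit vectors of $\mathbb{R}^5$. A polyhedron is an intersection of finitely many closed half-spaces with arbitrary real (possibly irrational) coefficients; it may be unbounded. For $X\subseteq\mathbb{Z}^d$, a relaxation of $X$ is a polyhedron $Q\subseteq\mathbb{R}^d$ with $Q\cap\mathbb{Z}^d=X$. The relaxation complexity $\operatorname{rc}(X)$ is the minimal number of facets of a relaxation of $X$ ($\infty$ if no relaxation exists). *)

theory Defs
  imports "HOL-Analysis.Analysis" "HOL-Library.Extended_Nat"
begin

definition integer_lattice :: "(real ^ 'n) set" where
  "integer_lattice = {x. \<forall>i. x $ i \<in> \<int>}"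

definition relaxation :: "(real ^ 'n) set \<Rightarrow> (real ^ 'n) set \<Rightarrow> bool" where
  "relaxation X Q \<longleftrightarrow> polyhedron Q \<and> Q \<inter> integer_lattice = X"

text \<open>
  A polyhedron has only finitely many facets, so the use of \<^const>\<open>card\<close> is harmless.
  The infimum in \<^typ>\<open>enat\<close> is attained if a relaxation exists, and is
  \<open>\<infinity>\<close> otherwise.
\<close>
definition rc :: "(real ^ 'n) set \<Rightarrow> enat" where
  "rc X = (INF Q\<in>{Q. relaxation X Q}. enat (card {F. F facet_of Q}))"

definition Delta5 :: "(real ^ 5) set" where
  "Delta5 = insert 0 (range (\<lambda>i. axis i 1))"

end

theory Submission imports Defs begin

text \<open>
  Lower bound. Suppose a relaxation has at most four facets. Their normals are orthogonal to a line,
  so by Dirichlet there are nonzero integer vectors \<open>z\<close> on which all normals take arbitrarily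
  small values. If a vertex \<open>v\<close> lay on at most one facet, then \<open>v + z\<close> and \<open>v + 2z\<close> would lie
  in the relaxation for \<open>z\<close> or \<open>-z\<close>. Hence every vertex has positive slack at two facets at most.
  Some vertex \<open>v\<close> is not chosen as a maximiser of the slack of any facet; with \<open>C\<close>, \<open>D\<close> the facets
  of positive slack at \<open>v\<close> and \<open>p\<close>, \<open>q\<close> their maximisers, the integer point \<open>p + q - v\<close> lies in the
  relaxation.

  Upper bound. A triangular bipyramid \<open>B\<close> in dimension three can touch the six points of
  \<open>{0,1}\<^sup>3 - {(0,0,0), (1,1,1)}\<close>, one in each facet, and contain no further integer point. It is
  the projection of a four-dimensional simplex \<open>T\<close>, whose fibres over the boundary of \<open>B\<close> are single
  points. The six points lifted to \<open>T\<close> are the images of the vertices of \<open>\<Delta>\<^sub>5\<close> under an affine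
  map from dimension five, and the preimage of \<open>T\<close> has five facets. For a suitable irrational \<open>B\<close> this
  map is injective on the integer lattice, so the preimage of \<open>T\<close> is a relaxation.
\<close>

section \<open>Facets and half-spaces of polyhedra\<close>

text \<open>The segment from an interior point to a point outside \<open>S\<close> meets the
  boundary in a facet, whose inequality is strict at the start, tight at that point and hence
  violated at the end.\<close>

lemma polyhedron_eq_facet_halfspaces:
  fixes S :: "'a::euclidean_space set"
  assumes S: "polyhedron S" and int: "interior S \<noteq> {}"
    and ab: "\<And>C. C facet_of S \<Longrightarrow> S \<subseteq> {x. a C \<bullet> x \<le> b C} \<and> C = S \<inter> {x. a C \<bullet> x = b C}"
  shows "S = {x. \<forall>C. C facet_of S \<longrightarrow> a C \<bullet> x \<le> b C}"
proof (intro equalityI subsetI)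
  fix x assume "x \<in> S"
  then show "x \<in> {x. \<forall>C. C facet_of S \<longrightarrow> a C \<bullet> x \<le> b C}"
    using ab by blast
next
  fix x assume x: "x \<in> {x. \<forall>C. C facet_of S \<longrightarrow> a C \<bullet> x \<le> b C}"
  have rel: "interior S = S - \<Union>{F. F facet_of S}"
    using rel_interior_of_polyhedron[OF S] rel_interior_nonempty_interior[OF int] by simp
  show "x \<in> S"
  proof (rule ccontr)
    assume "x \<notin> S"
    obtain y where y: "y \<in> interior S" using int by blast
    then have "closed_segment y x \<inter> frontier S \<noteq> {}"
      using \<open>x \<notin> S\<close> interior_subset by (intro connected_Int_frontier) auto
    then obtain z where z: "z \<in> closed_segment y x" "z \<in> frontier S" by blast
    have "z \<in> S" "z \<notin> interior S"
      using z(2) polyhedron_imp_closed[OF S] by (auto simp: frontier_def)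
    then obtain C where C: "C facet_of S" "z \<in> C" using rel by blast
    have az: "a C \<bullet> z = b C" using ab[OF C(1)] C(2) by blast
    have "y \<in> S" "y \<notin> C" using y rel C(1) by auto
    then have ay: "a C \<bullet> y < b C" using ab[OF C(1)] by force
    obtain u where u: "0 \<le> u" "u \<le> 1" "z = (1 - u) *\<^sub>R y + u *\<^sub>R x"
      using z(1) by (auto simp: in_segment)
    have "u \<noteq> 1" using u \<open>z \<in> S\<close> \<open>x \<notin> S\<close> by auto
    then have "(1 - u) * (a C \<bullet> y) < (1 - u) * b C" using ay u by simp
    moreover have "u * (a C \<bullet> x) \<le> u * b C"
      using x C(1) u(1) by (simp add: mult_left_mono)
    moreover have "a C \<bullet> z = (1 - u) * (a C \<bullet> y) + u * (a C \<bullet> x)"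
      using u(3) by (simp add: inner_add_right)
    ultimately show False using az by (simp add: algebra_simps)
  qed
qed

text \<open>A smallest subfamily of \<open>H\<close> that still cuts \<open>\<Inter>H\<close> out of
  its affine hull is irredundant, so every facet comes from one of its members.\<close>

lemma card_facets_le_card_halfspaces:
  fixes H :: "'a::euclidean_space set set"
  assumes "finite H" and H: "\<And>h. h \<in> H \<Longrightarrow> \<exists>a b. a \<noteq> 0 \<and> h = {x. a \<bullet> x \<le> b}"
  shows "card {C. C facet_of \<Inter>H} \<le> card H"
proof -
  let ?S = "\<Inter>H"
  define P where "P = (\<lambda>G. G \<subseteq> H \<and> ?S = affine hull ?S \<inter> \<Inter>G)"
  have "P H" unfolding P_def using hull_subset[of ?S affine] by blast
  then obtain G where G: "P G" and least: "\<And>G'. P G' \<Longrightarrow> card G \<le> card G'"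
    using ex_has_least_nat[of P H card] by blast
  have "finite G" using G \<open>finite H\<close> by (auto simp: P_def intro: finite_subset)
  have min: "?S \<subset> affine hull ?S \<inter> \<Inter>G'" if "G' \<subset> G" for G'
  proof -
    have "\<not> P G'" using least[of G'] psubset_card_mono[OF \<open>finite G\<close> that] by auto
    moreover have "?S \<subseteq> affine hull ?S \<inter> \<Inter>G'" using G that by (auto simp: P_def)
    ultimately show ?thesis using that G by (auto simp: P_def)
  qed
  from G H have "\<forall>h\<in>G. \<exists>a b. a \<noteq> 0 \<and> h = {x. a \<bullet> x \<le> b}" by (auto simp: P_def)
  then obtain a b where ab: "\<And>h. h \<in> G \<Longrightarrow> a h \<noteq> 0 \<and> h = {x. a h \<bullet> x \<le> b h}"
    by metis
  have "?S = affine hull ?S \<inter> \<Inter>G" using G by (simp add: P_def)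
  then have "C facet_of ?S \<longleftrightarrow> (\<exists>h. h \<in> G \<and> C = ?S \<inter> {x. a h \<bullet> x = b h})" for C
    by (rule facet_of_polyhedron_explicit[OF \<open>finite G\<close>]) (use ab min in auto)
  then have "{C. C facet_of ?S} = (\<lambda>h. ?S \<inter> {x. a h \<bullet> x = b h}) ` G" by auto
  then have "card {C. C facet_of ?S} \<le> card G" using card_image_le[OF \<open>finite G\<close>] by simp
  also have "\<dots> \<le> card H" using G \<open>finite H\<close> by (auto simp: P_def intro: card_mono)
  finally show ?thesis .
qed

section \<open>Integer vectors nearly orthogonal to few normals\<close>

text \<open>Some nonzero \<open>u\<close> is orthogonal to all of \<open>A\<close>; simultaneous
  Dirichlet approximation makes a multiple of \<open>u\<close> nearly integral, and \<open>z\<close>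
  is its rounding.\<close>

lemma small_inner_integer_vector:
  fixes A :: "(real^'n) set"
  assumes "finite A" "card A < CARD('n)" "\<epsilon> > 0"
  obtains z where "z \<in> integer_lattice" "z \<noteq> 0" "\<And>a. a \<in> A \<Longrightarrow> \<bar>a \<bullet> z\<bar> < \<epsilon>"
proof -
  have "dim A < DIM(real^'n)" using dim_le_card'[OF assms(1)] assms(2) by simp
  then obtain u' :: "real^'n" where u': "u' \<noteq> 0" "\<And>y. y \<in> span A \<Longrightarrow> orthogonal u' y"
    using orthogonal_to_subspace_exists by blast
  then obtain k where k: "u' $ k \<noteq> 0" by (auto simp: vec_eq_iff)
  \<comment> \<open>With coordinate \<open>k\<close> scaled to 1, an error below 1 forces
    \<open>z $ k = q\<close>, so \<open>z\<close> is nonzero.\<close>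
  define u where "u = (1 / u' $ k) *\<^sub>R u'"
  have uk: "u $ k = 1" using k by (simp add: u_def)
  have au: "a \<bullet> u = 0" if "a \<in> A" for a
    using u'(2)[OF span_base[OF that]] by (simp add: u_def orthogonal_def inner_commute)
  define M where "M = (\<Sum>a\<in>A. \<Sum>i\<in>UNIV. \<bar>a $ i\<bar>)"
  obtain N :: nat where N: "M / \<epsilon> < real N" using reals_Archimedean2 by blast
  have "M \<ge> 0" by (auto simp: M_def intro!: sum_nonneg)
  then have "M / \<epsilon> \<ge> 0" using \<open>\<epsilon> > 0\<close> by simp
  then have N0: "N > 0" using N by (cases "N = 0") auto
  obtain f :: "nat \<Rightarrow> 'n" and m where f: "UNIV = f ` {i. i < m}"
    using finite_imp_nat_seg_image_inj_on[OF finite[of "UNIV::'n set"]] by metis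
  obtain q p where q: "0 < q" and p: "\<And>i. i < m \<Longrightarrow> \<bar>of_int q * u $ f i - of_int (p i)\<bar> < 1 / real N"
    using Dirichlet_approx_simult[OF N0, of m "\<lambda>i. u $ f i"] by metis
  have "\<exists>j. i = f j \<and> j < m" for i using f by blast
  then obtain g where g: "\<And>i. i = f (g i) \<and> g i < m" by metis
  define z :: "real^'n" where "z = (\<chi> i. of_int (p (g i)))"
  have close: "\<bar>of_int q * u $ i - z $ i\<bar> < 1 / real N" for i
    using p[of "g i"] g[of i] by (simp add: z_def)
  have "1 / real N \<le> 1" using N0 by simp
  then have "\<bar>of_int (q - p (g k))\<bar> < (1::real)" using close[of k] uk by (simp add: z_def)
  then have "p (g k) = q" by linarith
  then have "z $ k \<noteq> 0" using q by (simp add: z_def)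
  then have "z \<noteq> 0" by auto
  moreover have "z \<in> integer_lattice" by (simp add: integer_lattice_def z_def)
  moreover have "\<bar>a \<bullet> z\<bar> < \<epsilon>" if "a \<in> A" for a
  proof -
    have "a \<bullet> z = - (a \<bullet> (of_int q *\<^sub>R u - z))" using au[OF that] by (simp add: inner_diff_right)
    also have "\<dots> = - (\<Sum>i\<in>UNIV. a $ i * (of_int q * u $ i - z $ i))"
      by (simp add: inner_vec_def)
    finally have "\<bar>a \<bullet> z\<bar> \<le> (\<Sum>i\<in>UNIV. \<bar>a $ i * (of_int q * u $ i - z $ i)\<bar>)"
      using sum_abs by simp
    also have "\<dots> \<le> (\<Sum>i\<in>UNIV. \<bar>a $ i\<bar> * (1 / real N))"
      unfolding abs_mult using close by (intro sum_mono mult_left_mono) (auto intro: less_imp_le)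
    also have "\<dots> = (\<Sum>i\<in>UNIV. \<bar>a $ i\<bar>) / real N" by (simp add: sum_divide_distrib)
    also have "\<dots> \<le> M / real N"
      unfolding M_def using that \<open>finite A\<close> N0
      by (intro divide_right_mono member_le_sum) (auto intro: sum_nonneg)
    also have "\<dots> < \<epsilon>" using N N0 \<open>\<epsilon> > 0\<close> by (simp add: field_simps)
    finally show ?thesis .
  qed
  ultimately show ?thesis using that by blast
qed

section \<open>Vertices of the simplex\<close>

lemma Delta5_eq_insert_Basis: "Delta5 = insert 0 Basis"
  by (auto simp: Delta5_def Basis_vec_def)

lemma Delta5_nth: "v \<in> Delta5 \<Longrightarrow> v $ i = 0 \<or> v $ i = 1"
  by (auto simp: Delta5_def axis_def)

lemma Delta5_subset_integer_lattice: "Delta5 \<subseteq> integer_lattice"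
  by (auto simp: Delta5_def axis_def integer_lattice_def)

lemma finite_Delta5: "finite Delta5" and card_Delta5: "card Delta5 = 6"
  by (simp_all add: Delta5_eq_insert_Basis card_insert_if)

lemma Delta5_sum: "v \<in> Delta5 \<Longrightarrow> (\<Sum>i\<in>UNIV. v $ i) = (if v = 0 then 0 else 1)"
  by (auto simp: Delta5_def axis_def)

lemma Delta5_no_progression:
  assumes "v \<in> Delta5" "v + z \<in> Delta5" "v + 2 *\<^sub>R z \<in> Delta5"
  shows "z = 0"
proof -
  have "z $ i = 0" for i
    using assms[THEN Delta5_nth, of i] by auto
  then show ?thesis by (simp add: vec_eq_iff)
qed

text \<open>The coordinate sum of \<open>p + q - v\<close> is 2 if \<open>v = 0\<close>; otherwise
  its coordinate along \<open>v\<close> is -1.\<close>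

lemma Delta5_add_diff_notin:
  assumes "p \<in> Delta5" "q \<in> Delta5" "v \<in> Delta5" "p \<noteq> v" "q \<noteq> v"
  shows "p + q - v \<notin> Delta5"
proof
  assume w: "p + q - v \<in> Delta5"
  show False
  proof (cases "v = 0")
    case True
    then show False using Delta5_sum[OF w] assms(4,5) Delta5_sum[OF assms(1)] Delta5_sum[OF assms(2)]
      by (simp add: sum.distrib split: if_splits)
  next
    case False
    then obtain i where i: "v = axis i 1" using assms(3) by (auto simp: Delta5_def)
    have "p $ i = 0" "q $ i = 0" using assms i by (auto simp: Delta5_def axis_def)
    then show False using Delta5_nth[OF w, of i] i by (simp add: axis_def)
  qed
qed

lemma subset_pair_if_card_le_2:
  assumes "finite A" "card A \<le> 2" "A \<subseteq> B" "B \<noteq> {}"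
  obtains x y where "x \<in> B" "y \<in> B" "A \<subseteq> {x, y}"
proof -
  consider "card A = 0" | "card A = 1" | "card A = 2" using assms(2) by linarith
  then show ?thesis
  proof cases
    case 1
    then have "A = {}" using assms(1) by simp
    moreover obtain x where "x \<in> B" using assms(4) by blast
    ultimately show ?thesis using that[of x x] by simp
  next
    case 2
    then obtain x where "A = {x}" by (rule card_1_singletonE)
    then show ?thesis using that[of x x] assms(3) by simp
  next
    case 3
    then obtain x y where "A = {x, y}" by (auto simp: card_2_iff)
    then show ?thesis using that[of x y] assms(3) by simp
  qed
qed

section \<open>Lower bound\<close>

lemma card_facets_relaxation_Delta5:
  assumes "relaxation Delta5 Q"
  shows "5 \<le> card {C. C facet_of Q}"
proof (rule ccontr)
  assume "\<not> 5 \<le> card {C. C facet_of Q}"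
  then have card: "card {C. C facet_of Q} \<le> 4" by simp
  have poly: "polyhedron Q" and lat: "Q \<inter> integer_lattice = Delta5"
    using assms by (auto simp: relaxation_def)
  let ?F = "{C. C facet_of Q}"
  have fin: "finite ?F" using finite_polyhedron_facets[OF poly] .
  have sub: "Delta5 \<subseteq> Q" using lat by blast
  \<comment> \<open>\<open>Q\<close> contains a full-dimensional simplex, so its facet inequalities
    alone describe it.\<close>
  have "convex hull Delta5 \<subseteq> Q" using sub polyhedron_imp_convex[OF poly] by (rule hull_minimal)
  then have "interior Q \<noteq> {}"
    using interior_std_simplex_nonempty[where 'a="real^5"] interior_mono
    unfolding Delta5_eq_insert_Basis by (metis empty_iff subsetD)
  have "\<forall>C. \<exists>a b. C facet_of Q \<longrightarrow> Q \<subseteq> {x. a \<bullet> x \<le> b} \<and> C = Q \<inter> {x. a \<bullet> x = b}"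
    using facet_of_polyhedron[OF poly] by metis
  then obtain a b
    where ab: "\<And>C. C facet_of Q \<Longrightarrow> Q \<subseteq> {x. a C \<bullet> x \<le> b C} \<and> C = Q \<inter> {x. a C \<bullet> x = b C}"
    by metis
  have Q: "Q = {x. \<forall>C\<in>?F. a C \<bullet> x \<le> b C}"
    using polyhedron_eq_facet_halfspaces[OF poly \<open>interior Q \<noteq> {}\<close> ab] by auto
  define s where "s = (\<lambda>C v. b C - a C \<bullet> v)"
  have s_nonneg: "0 \<le> s C v" if "C \<in> ?F" "v \<in> Delta5" for C v
    using sub that Q by (auto simp: s_def)
  have in_Delta5: "x \<in> Delta5" if "x \<in> integer_lattice" "\<And>C. C \<in> ?F \<Longrightarrow> 0 \<le> s C x" for x
    using that lat Q by (auto simp: s_def)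
  have tight: "2 \<le> card {C \<in> ?F. s C v = 0}" if v: "v \<in> Delta5" for v
  proof (rule ccontr)
    let ?Z = "{C \<in> ?F. s C v = 0}"
    assume "\<not> 2 \<le> card ?Z"
    then have "card ?Z \<le> Suc 0" by simp
    moreover have "finite ?Z" using fin by simp
    ultimately have Z1: "\<And>C D. C \<in> ?Z \<Longrightarrow> D \<in> ?Z \<Longrightarrow> C = D"
      by (simp add: card_le_Suc0_iff_eq)
    \<comment> \<open>The 1 keeps the set nonempty when no slack at \<open>v\<close> is positive.
      Changes below \<open>\<epsilon> / 2\<close> leave room for the double step
      \<open>2y\<close>.\<close>
    define \<epsilon> where "\<epsilon> = Min (insert 1 ((\<lambda>C. s C v) ` (?F - ?Z)))"
    have "0 < \<epsilon>"
      unfolding \<epsilon>_def using fin s_nonneg[OF _ v] by (subst Min_gr_iff) (auto simp: less_le)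
    have \<epsilon>: "\<epsilon> \<le> s C v" if "C \<in> ?F" "s C v \<noteq> 0" for C
      using fin that by (auto simp: \<epsilon>_def intro!: Min_le)
    have "card (a ` ?F) < CARD(5)" using card_image_le[OF fin, of a] card by simp
    then obtain z where z: "z \<in> integer_lattice" "z \<noteq> 0" "\<And>C. C \<in> ?F \<Longrightarrow> \<bar>a C \<bullet> z\<bar> < \<epsilon> / 2"
      using small_inner_integer_vector[of "a ` ?F" "\<epsilon> / 2"] fin \<open>0 < \<epsilon>\<close>
      by (metis finite_imageI half_gt_zero image_eqI)
    \<comment> \<open>At most one facet is tight at \<open>v\<close>, so \<open>z\<close> or
      \<open>-z\<close> does not leave it.\<close>
    obtain y where y: "y \<in> integer_lattice" "y \<noteq> 0" "\<And>C. C \<in> ?F \<Longrightarrow> \<bar>a C \<bullet> y\<bar> < \<epsilon> / 2"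
      "\<And>C. C \<in> ?Z \<Longrightarrow> a C \<bullet> y \<le> 0"
    proof (cases "\<forall>C\<in>?Z. a C \<bullet> z \<le> 0")
      case True
      then show ?thesis using that z by blast
    next
      case False
      then obtain D where "D \<in> ?Z" "a D \<bullet> (- z) \<le> 0" by auto
      then have "\<forall>C\<in>?Z. a C \<bullet> (- z) \<le> 0" using Z1[of _ D] by blast
      moreover have "- z \<in> integer_lattice" using z(1) by (simp add: integer_lattice_def)
      ultimately show ?thesis using that[of "- z"] z(2,3) by simp
    qed
    have "v + t *\<^sub>R y \<in> Delta5" if t: "t = 1 \<or> t = 2" for t
    proof (rule in_Delta5)
      show "v + t *\<^sub>R y \<in> integer_lattice"
        using v y(1) Delta5_subset_integer_lattice t by (auto simp: integer_lattice_def)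
      fix C assume C: "C \<in> ?F"
      show "0 \<le> s C (v + t *\<^sub>R y)"
      proof (cases "s C v = 0")
        case True
        then have "a C \<bullet> y \<le> 0" using y(4) C by simp
        then show ?thesis using True t by (auto simp: s_def inner_add_right)
      next
        case False
        then show ?thesis using \<epsilon>[OF C] y(3)[OF C] t by (auto simp: s_def inner_add_right)
      qed
    qed
    from this[of 1] this[of 2] have "v + y \<in> Delta5" "v + 2 *\<^sub>R y \<in> Delta5" by auto
    then show False using Delta5_no_progression[OF v] y(2) by blast
  qed
  have "\<exists>v\<in>Delta5. \<forall>w\<in>Delta5. s C w \<le> s C v" for C
  proof -
    have "Max (s C ` Delta5) \<in> s C ` Delta5" using finite_Delta5 card_Delta5 by (intro Max_in) auto
    then obtain v where "v \<in> Delta5" "Max (s C ` Delta5) = s C v" by auto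
    moreover have "s C w \<le> Max (s C ` Delta5)" if "w \<in> Delta5" for w
      using that finite_Delta5 by simp
    ultimately show ?thesis by auto
  qed
  then obtain J where J: "\<And>C. J C \<in> Delta5" "\<And>C w. w \<in> Delta5 \<Longrightarrow> s C w \<le> s C (J C)" by metis
  have "card (J ` ?F) < card Delta5" using card_image_le[OF fin, of J] card card_Delta5 by simp
  then have "\<not> Delta5 \<subseteq> J ` ?F" using card_mono[of "J ` ?F" Delta5] fin by auto
  then obtain v where v: "v \<in> Delta5" "v \<notin> J ` ?F" by blast
  let ?Z = "{C \<in> ?F. s C v = 0}"
  have "card (?F - ?Z) = card ?F - card ?Z" using fin by (intro card_Diff_subset) auto
  then have "card (?F - ?Z) \<le> 2" using tight[OF v(1)] card by simp
  moreover have "?F \<noteq> {}"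
  proof
    assume "?F = {}"
    then have "card ?Z = 0" by simp
    then show False using tight[OF v(1)] by linarith
  qed
  moreover have "finite (?F - ?Z)" using fin by simp
  ultimately obtain C D where CD: "C \<in> ?F" "D \<in> ?F" "?F - ?Z \<subseteq> {C, D}"
    using subset_pair_if_card_le_2[of "?F - ?Z" ?F] by blast
  \<comment> \<open>For \<open>E\<close> equal to \<open>C\<close> or \<open>D\<close>, one of the
    two added slacks is maximal and pays for \<open>s E v\<close>; every other facet has
    \<open>s E v = 0\<close>.\<close>
  have "J C + J D - v \<in> Delta5"
  proof (rule in_Delta5)
    show "J C + J D - v \<in> integer_lattice"
      using J(1) v(1) Delta5_subset_integer_lattice by (auto simp: integer_lattice_def subset_iff)
    fix E assume E: "E \<in> ?F"
    have "s E (J C + J D - v) = s E (J C) + s E (J D) - s E v"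
      by (simp add: s_def inner_add_right inner_diff_right)
    moreover have "s E v = 0 \<or> E = C \<or> E = D" using E CD(3) by blast
    ultimately show "0 \<le> s E (J C + J D - v)"
      using s_nonneg[OF E J(1)[of C]] s_nonneg[OF E J(1)[of D]] J(2)[OF v(1), of E] by auto
  qed
  moreover have "J C \<noteq> v" "J D \<noteq> v" using v(2) CD(1,2) by blast+
  ultimately show False using Delta5_add_diff_notin[OF J(1) J(1) v(1)] by blast
qed

section \<open>Upper bound: integer points of the bipyramid and the prism\<close>

text \<open>For nonzero \<open>q\<close>, the exponent of 2 is even in \<open>p\<^sup>2\<close> and
  odd in \<open>2 * q\<^sup>2\<close>.\<close>

lemma int_mult_sqrt2_eq:
  assumes "of_int p = of_int q * sqrt 2"
  shows "p = 0 \<and> q = 0"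
proof -
  have "real_of_int (p\<^sup>2) = real_of_int (2 * q\<^sup>2)" using assms by (simp add: power_mult_distrib)
  then have eq: "p\<^sup>2 = 2 * q\<^sup>2" by linarith
  have "q = 0"
  proof (rule ccontr)
    assume "q \<noteq> 0"
    then have "p \<noteq> 0" using eq by auto
    have "multiplicity 2 (p\<^sup>2) = 2 * multiplicity 2 p" "multiplicity 2 (q\<^sup>2) = 2 * multiplicity 2 q"
      using \<open>p \<noteq> 0\<close> \<open>q \<noteq> 0\<close> by (simp_all add: prime_elem_multiplicity_power_distrib)
    moreover have "multiplicity 2 (2 * q\<^sup>2) = Suc (multiplicity 2 (q\<^sup>2))"
      using \<open>q \<noteq> 0\<close> by (intro multiplicity_times_same) auto
    ultimately have "2 * multiplicity 2 p = Suc (2 * multiplicity 2 q)" using eq by simp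
    then show False by presburger
  qed
  then show ?thesis using eq by simp
qed

text \<open>
  The coefficients arise from the symmetric bipyramid \<open>a + 2b + 3c \<ge> 1\<close>, \<open>3a + 2b + c \<le> 5\<close> and
  their cyclic shifts by a perturbation that keeps each facet on its integer point.
\<close>

lemma bipyramid_integer_points:
  fixes a b c :: int
  assumes "a + 2 * b + 3 * c \<ge> 1" "6 * a + 3 * b + 5 * c \<ge> 3" "4 * a + 3 * b + 7 * c \<le> 11"
    and "4 * a + 6 * b + 2 * c - 2 + sqrt 2 * (a + c - 1) \<ge> 0"
    and "11 - 6 * a - 5 * b - 3 * c - sqrt 2 * (a + c - 1) \<ge> 0"
    and "10 - 2 * a - 6 * b - 4 * c - sqrt 2 * (a + c - 1) \<ge> 0"
  shows "(a, b, c) \<in> {(1,0,0), (0,1,0), (0,0,1), (0,1,1), (1,0,1), (1,1,0)}"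
proof -
  have s: "1.4 \<le> sqrt 2" "sqrt 2 \<le> 1.5"
    by (rule real_le_rsqrt, simp add: power2_eq_square) (rule real_le_lsqrt, auto simp: power2_eq_square)
  define t where "t = sqrt 2 * real_of_int (a + c - 1)"
  have t: "4 * real_of_int a + 6 * b + 2 * c - 2 + t \<ge> 0"
      "11 - 6 * real_of_int a - 5 * b - 3 * c - t \<ge> 0"
      "10 - 2 * real_of_int a - 6 * b - 4 * c - t \<ge> 0"
    using assms(4-6) by (simp_all add: t_def)
  show ?thesis
  \<comment> \<open>The sign of \<open>a + c - 1\<close> decides whether 1.4 or 1.5 relaxes an
    inequality. The resulting integer inequalities confine the point to a small box, which is
    enumerated.\<close>
  proof (cases "a + c \<ge> 1")
    case True
    then have "1.4 * real_of_int (a + c - 1) \<le> t" "t \<le> 1.5 * real_of_int (a + c - 1)"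
      unfolding t_def using s by (intro mult_right_mono; simp)+
    with t have "real_of_int (11 * a + 12 * b + 7 * c) \<ge> 7"
        "real_of_int (37 * a + 25 * b + 22 * c) \<le> 62" "real_of_int (17 * a + 30 * b + 27 * c) \<le> 57"
      by (simp_all add: field_simps)
    then have ineqs: "11 * a + 12 * b + 7 * c \<ge> 7" "37 * a + 25 * b + 22 * c \<le> 62"
        "17 * a + 30 * b + 27 * c \<le> 57"
      by linarith+
    have "-1 \<le> a" "a \<le> 2" "-2 \<le> b" "b \<le> 1" "-1 \<le> c" "c \<le> 2"
      using ineqs assms(1-3) True by linarith+
    then have "a \<in> {-1,0,1,2}" "b \<in> {-2,-1,0,1}" "c \<in> {-1,0,1,2}" by auto
    then show ?thesis using ineqs assms(1-3) True by (elim insertE emptyE) (hypsubst, simp)+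
  next
    case False
    then have "1.5 * real_of_int (a + c - 1) \<le> t" "t \<le> 1.4 * real_of_int (a + c - 1)"
      unfolding t_def using s by (intro mult_right_mono_neg; simp)+
    with t have "real_of_int (27 * a + 30 * b + 17 * c) \<ge> 17"
        "real_of_int (15 * a + 10 * b + 9 * c) \<le> 25" "real_of_int (7 * a + 12 * b + 11 * c) \<le> 23"
      by (simp_all add: field_simps)
    then have ineqs: "27 * a + 30 * b + 17 * c \<ge> 17" "15 * a + 10 * b + 9 * c \<le> 25"
        "7 * a + 12 * b + 11 * c \<le> 23"
      by linarith+
    have "-1 \<le> a" "a \<le> 1" "0 \<le> b" "b \<le> 3" "-2 \<le> c" "c \<le> 2"
      using ineqs assms(1-3) False by linarith+
    then have "a \<in> {-1,0,1}" "b \<in> {0,1,2,3}" "c \<in> {-2,-1,0,1,2}" by auto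
    then show ?thesis using ineqs assms(1-3) False by (elim insertE emptyE) (hypsubst, simp)+
  qed
qed

lemma exhaust_5:
  fixes x :: 5
  shows "x = 1 \<or> x = 2 \<or> x = 3 \<or> x = 4 \<or> x = 5"
proof (induct x)
  case (of_int z)
  \<comment> \<open>Residue 0 is the index 5.\<close>
  then have "z = 0 \<or> z = 1 \<or> z = 2 \<or> z = 3 \<or> z = 4" by fastforce
  then show ?case by auto
qed

lemma forall_5: "(\<forall>i::5. P i) \<longleftrightarrow> P 1 \<and> P 2 \<and> P 3 \<and> P 4 \<and> P 5"
  by (metis exhaust_5)

text \<open>The real solutions over each of the six bipyramid points form a line, whose irrational
  direction admits only one integer point.\<close>

lemma integer_points_of_prism:
  fixes x1 x2 x3 x4 x5 :: int and s1 s2 s3 s4 s5 :: real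
  defines "s1 \<equiv> 2 * x2 + 4 * x3 + 3 * x4 + (2 - sqrt 2) * x5"
    and "s2 \<equiv> 2 + x1 - 2 * x2 - 2 * x4 + (2 - sqrt 2) * x5"
    and "s3 \<equiv> 4 - 2 * x1 - sqrt 2 * x2 - 4 * x3 - 3 * x4 - 4 * x5"
    and "s4 \<equiv> 4 - 4 * x1 - 4 * x2 - 4 * x3 + x4 + sqrt 2 * x5"
    and "s5 \<equiv> 5 * x1 + (4 + sqrt 2) * x2 + 4 * x3"
  assumes nonneg: "0 \<le> s1" "0 \<le> s2" "0 \<le> s3" "0 \<le> s4" "0 \<le> s5"
  shows "(x1, x2, x3, x4, x5) \<in>
    {(0,0,0,0,0), (1,0,0,0,0), (0,1,0,0,0), (0,0,1,0,0), (0,0,0,1,0), (0,0,0,0,1)}"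
proof -
  \<comment> \<open>a sum of an upper and a lower slack depends only on the projection to the bipyramid\<close>
  define a b c where abc: "a = 1 - x2 - x3 - x4" "b = 1 - x1 - x3 - x5" "c = x3 + x4 + x5"
  have eqs: "s1 + s4 = of_int (2 * (a + 2 * b + 3 * c - 1))"
    "s2 + s4 = of_int (6 * a + 3 * b + 5 * c - 3)"
    "s3 + s4 = 4 * a + 6 * b + 2 * c - 2 + sqrt 2 * (a + c - 1)"
    "s1 + s5 = 11 - 6 * a - 5 * b - 3 * c - sqrt 2 * (a + c - 1)"
    "s2 + s5 = 10 - 2 * a - 6 * b - 4 * c - sqrt 2 * (a + c - 1)"
    "s3 + s5 = of_int (11 - 4 * a - 3 * b - 7 * c)"
    by (simp_all add: abc s1_def s2_def s3_def s4_def s5_def algebra_simps)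
  have abc_cases: "(a, b, c) \<in> {(1,0,0), (0,1,0), (0,0,1), (0,1,1), (1,0,1), (1,1,0)}"
    by (rule bipyramid_integer_points) (use nonneg eqs in linarith)+
  \<comment> \<open>Each of the six points makes one of the six sums vanish, hence both of its
    nonnegative summands.\<close>
  then have "s4 = 0 \<and> (a, b, c) \<in> {(1,0,0), (0,1,0), (0,0,1)} \<or>
      s5 = 0 \<and> (a, b, c) \<in> {(0,1,1), (1,0,1), (1,1,0)}"
    using nonneg eqs by (elim insertE emptyE) auto
  then show ?thesis
  proof (elim disjE conjE)
    assume "s4 = 0" and P: "(a, b, c) \<in> {(1,0,0), (0,1,0), (0,0,1)}"
    \<comment> \<open>The rational part and the coefficient of \<open>sqrt 2\<close> vanish
      separately, which adds two integer equations to the three that fix the projection.\<close>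
    then have "of_int (4 * x1 + 4 * x2 + 4 * x3 - 4 - x4) = of_int x5 * sqrt 2"
      by (simp add: s4_def algebra_simps)
    from int_mult_sqrt2_eq[OF this] have "4 * x1 + 4 * x2 + 4 * x3 - 4 - x4 = 0" "x5 = 0"
      by auto
    moreover have "a + b + c = 1" using P by auto
    ultimately have "x1 = a" "x2 = b" "x3 = c" "x4 = 0" "x5 = 0" using abc by linarith+
    then show ?thesis using P by auto
  next
    assume "s5 = 0" and G: "(a, b, c) \<in> {(0,1,1), (1,0,1), (1,1,0)}"
    then have "of_int (- 5 * x1 - 4 * x2 - 4 * x3) = of_int x2 * sqrt 2"
      by (simp add: s5_def algebra_simps)
    from int_mult_sqrt2_eq[OF this] have "- 5 * x1 - 4 * x2 - 4 * x3 = 0" "x2 = 0"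
      by auto
    moreover have "a + b + c = 2" using G by auto
    ultimately have "x1 = 0" "x2 = 0" "x3 = 0" "x4 = 1 - a" "x5 = 1 - b" using abc by linarith+
    then show ?thesis using G by auto
  qed
qed

section \<open>The five half-spaces and the final count\<close>

definition halfspace5 :: "real \<Rightarrow> real \<Rightarrow> real \<Rightarrow> real \<Rightarrow> real \<Rightarrow> real \<Rightarrow> (real^5) set" where
  "halfspace5 d c1 c2 c3 c4 c5 = {x. 0 \<le> d + c1 * x$1 + c2 * x$2 + c3 * x$3 + c4 * x$4 + c5 * x$5}"

lemma halfspace5_normal_form:
  assumes "\<not> (c1 = 0 \<and> c2 = 0 \<and> c3 = 0 \<and> c4 = 0 \<and> c5 = 0)"
  shows "\<exists>a b. a \<noteq> 0 \<and> halfspace5 d c1 c2 c3 c4 c5 = {x. a \<bullet> x \<le> b}"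
proof (intro exI conjI)
  let ?a = "- (axis 1 c1 + axis 2 c2 + axis 3 c3 + axis 4 c4 + axis 5 c5 :: real^5)"
  show "?a \<noteq> 0" using assms by (simp add: vec_eq_iff forall_5 axis_def)
  show "halfspace5 d c1 c2 c3 c4 c5 = {x. ?a \<bullet> x \<le> d}"
    by (auto simp: halfspace5_def inner_diff_left inner_add_left inner_axis' algebra_simps)
qed

text \<open>
  The slacks at \<open>e\<^sub>1, \<dots>, e\<^sub>5, 0\<close> are, with \<open>r = \<surd>2\<close>, the rows
  \<open>(0,2,4,3,2-r,0)\<close>, \<open>(3,0,2,0,4-r,2)\<close>, \<open>(2,4-r,0,1,0,4)\<close>, \<open>(0,0,0,5,4+r,4)\<close>,
  \<open>(5,4+r,4,0,0,0)\<close>. The points of the bipyramid below \<open>e\<^sub>1, \<dots>, e\<^sub>5, 0\<close> are the unit vectors of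
  dimension three followed by their complements in \<open>(1,1,1)\<close>.
\<close>

definition prism_halfspaces :: "(real^5) set list" where
  "prism_halfspaces =
    [halfspace5 0 0 2 4 3 (2 - sqrt 2),
     halfspace5 2 1 (-2) 0 (-2) (2 - sqrt 2),
     halfspace5 4 (-2) (- sqrt 2) (-4) (-3) (-4),
     halfspace5 4 (-4) (-4) (-4) 1 (sqrt 2),
     halfspace5 0 5 (4 + sqrt 2) 4 0 0]"

lemma prism_halfspaces_normal_form:
  "h \<in> set prism_halfspaces \<Longrightarrow> \<exists>a b. a \<noteq> 0 \<and> h = {x. a \<bullet> x \<le> b}"
  using halfspace5_normal_form unfolding prism_halfspaces_def list.set insert_iff empty_iff
  by (elim disjE FalseE; hypsubst; simp)

lemma relaxation_prism: "relaxation Delta5 (\<Inter>(set prism_halfspaces))"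
proof -
  let ?Q = "\<Inter>(set prism_halfspaces)"
  have "polyhedron ?Q" unfolding polyhedron_def
    using prism_halfspaces_normal_form by (intro exI[of _ "set prism_halfspaces"]) auto
  moreover have "Delta5 \<subseteq> ?Q"
  proof
    have s: "sqrt 2 \<le> 2" by (rule real_le_lsqrt) auto
    fix x assume "x \<in> Delta5"
    then consider "x = 0" | i where "x = axis i 1" by (auto simp: Delta5_def)
    then show "x \<in> ?Q"
    proof cases
      case 1
      then show ?thesis by (simp add: prism_halfspaces_def halfspace5_def)
    next
      case 2
      then show ?thesis using exhaust_5[of i] s
        by (auto simp: prism_halfspaces_def halfspace5_def axis_def)
    qed
  qed
  moreover have "x \<in> Delta5" if "x \<in> ?Q" "x \<in> integer_lattice" for x
  proof -
    have "\<forall>i. \<exists>k::int. x $ i = of_int k" using that(2) by (auto simp: integer_lattice_def elim: Ints_cases)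
    then obtain k :: "5 \<Rightarrow> int" where k: "\<And>i. x $ i = of_int (k i)" by metis
    have "(k 1, k 2, k 3, k 4, k 5) \<in>
        {(0,0,0,0,0), (1,0,0,0,0), (0,1,0,0,0), (0,0,1,0,0), (0,0,0,1,0), (0,0,0,0,1)}"
      using that(1) by (intro integer_points_of_prism) (simp_all add: prism_halfspaces_def halfspace5_def k)
    then have "x = 0 \<or> x = axis 1 1 \<or> x = axis 2 1 \<or> x = axis 3 1 \<or> x = axis 4 1 \<or> x = axis 5 1"
      unfolding vec_eq_iff forall_5 k by (auto simp: axis_def)
    then show ?thesis by (auto simp: Delta5_def)
  qed
  ultimately show ?thesis unfolding relaxation_def using Delta5_subset_integer_lattice by blast
qed

theorem theorem1: "rc Delta5 = 5"
proof (rule antisym)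
  let ?Q = "\<Inter>(set prism_halfspaces)"
  have "card {F. F facet_of ?Q} \<le> card (set prism_halfspaces)"
    by (rule card_facets_le_card_halfspaces) (simp, rule prism_halfspaces_normal_form)
  \<comment> \<open>The length of the list bounds the count without a proof that the half-spaces are
    distinct.\<close>
  also have "\<dots> \<le> 5" using card_length[of prism_halfspaces] by (simp add: prism_halfspaces_def)
  finally have "enat (card {F. F facet_of ?Q}) \<le> 5" by (simp add: numeral_eq_enat)
  then show "rc Delta5 \<le> 5"
    unfolding rc_def using relaxation_prism by (intro INF_lower2[of ?Q]) auto
  show "5 \<le> rc Delta5"
    unfolding rc_def using card_facets_relaxation_Delta5
    by (intro INF_greatest) (simp add: numeral_eq_enat)
qed

end
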